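(* For every request sequence $\sigma$, every time $t$ and every $r\ge 1$, in the tree maintained by $\textsc{Random-Push}$ the expected depth at time $t$ of the item of rank $r$ is less than $\log_2 r + 3$ (and hence less than $\lfloor\log_2 r\rfloor+4$).
   Context: Self-adjusting complete tree model: a set $V$ of $n$ items is stored in a complete binary tree of $n$ servers, one item per server; the root has depth $0$ and an item's depth is that of its hosting server. A request sequence $\sigma=(\sigma^{(1)},\sigma^{(2)},\dots)$ is fixed in advance (oblivious adversary). The rank of an item $v$ at time $t$ is the number of distinct items requested since the last request of $v$ before $t$, including $v$. Algorithm $\textsc{Random-Push}$: upon a request to item $u$ hosted at server $s$ of depth $k$, it moves $u$ to the root and pushes the previous root item down along a random path starting at the root, where at each step one of the two children of the current server is chosen uniformly at random, for $k$ steps: each item on this path down to depth $k-1$ moves down one level to the next server on the path; the item $w$ previously hosted at the end of the path (at depth $k$) is moved to server $s$. *)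

theory Defs
  imports "HOL-Probability.Probability" "HOL-Library.Sublist"
begin

text \<open>A server is the list of left/right choices leading to it from the root \<open>[]\<close>;
  the children of \<open>s\<close> are \<open>s @ [False]\<close> and \<open>s @ [True]\<close>.\<close>

type_synonym server = "bool list"

abbreviation depth :: "server \<Rightarrow> nat" where
  "depth s \<equiv> length s"

text \<open>All leaves have depth \<open>L\<close>, so there are \<open>2 ^ (L + 1) - 1\<close> servers and a path of \<open>k\<close>
  uniformly random child choices exists for every depth \<open>k\<close> that occurs.\<close>

definition servers :: "nat \<Rightarrow> server set" where
  "servers L = {s. depth s \<le> L}"

text \<open>A state of the tree maps every item to its hosting server.\<close>

type_synonym 'a placement = "'a \<Rightarrow> server"

text \<open>The servers on the path to \<open>p\<close> are the prefixes of \<open>p\<close>.  If \<open>p\<close> is itself the server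
  of \<open>u\<close>, then the item at the end of the path is \<open>u\<close>, which ends up at the root.\<close>

definition push_down :: "'a placement \<Rightarrow> 'a \<Rightarrow> server \<Rightarrow> 'a placement" where
  "push_down host u p = (\<lambda>w.
     if w = u then []
     else if strict_prefix (host w) p then take (Suc (depth (host w))) p
     else if host w = p then host u
     else host w)"

definition random_path :: "nat \<Rightarrow> server pmf" where
  "random_path k = replicate_pmf k (pmf_of_set UNIV)"

definition random_push_serve :: "'a placement \<Rightarrow> 'a \<Rightarrow> 'a placement pmf" where
  "random_push_serve host u = map_pmf (push_down host u) (random_path (depth (host u)))"

text \<open>Requests are \<open>\<sigma> 1, \<sigma> 2, \<dots>\<close>; the value \<open>\<sigma> 0\<close> is not used.\<close>

primrec random_push_after :: "'a placement \<Rightarrow> (nat \<Rightarrow> 'a) \<Rightarrow> nat \<Rightarrow> 'a placement pmf" where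
  "random_push_after init \<sigma> 0 = return_pmf init"
| "random_push_after init \<sigma> (Suc m) =
     bind_pmf (random_push_after init \<sigma> m) (\<lambda>host. random_push_serve host (\<sigma> (Suc m)))"

text \<open>The tree at time \<open>t\<close> is the one in which the request \<open>\<sigma> t\<close> arrives.\<close>

definition random_push_at :: "'a placement \<Rightarrow> (nat \<Rightarrow> 'a) \<Rightarrow> nat \<Rightarrow> 'a placement pmf" where
  "random_push_at init \<sigma> t = random_push_after init \<sigma> (t - 1)"

definition expected_depth :: "'a placement \<Rightarrow> (nat \<Rightarrow> 'a) \<Rightarrow> nat \<Rightarrow> 'a \<Rightarrow> real" where
  "expected_depth init \<sigma> t v =
     measure_pmf.expectation (random_push_at init \<sigma> t) (\<lambda>host. real (depth (host v)))"

definition last_request :: "(nat \<Rightarrow> 'a) \<Rightarrow> nat \<Rightarrow> 'a \<Rightarrow> nat" where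
  "last_request \<sigma> t v = Max {i \<in> {1..<t}. \<sigma> i = v}"

text \<open>Only items requested before time \<open>t\<close> have a rank at time \<open>t\<close>.\<close>

definition has_rank :: "(nat \<Rightarrow> 'a) \<Rightarrow> nat \<Rightarrow> 'a \<Rightarrow> nat \<Rightarrow> bool" where
  "has_rank \<sigma> t v r \<longleftrightarrow>
     (\<exists>i\<in>{1..<t}. \<sigma> i = v) \<and> r = card (\<sigma> ` {last_request \<sigma> t v..<t})"

end

theory Submission
  imports Defs
begin

text \<open>Let \<open>D\<close> be the depth of \<open>v\<close>, and let \<open>W\<close> be the set of the \<open>r - 1\<close> items requested since
  the last request of \<open>v\<close>, at which \<open>D\<close> was \<open>0\<close>.  Only a request to an item deeper than \<open>v\<close>
  can move \<open>v\<close>; it increases \<open>D\<close> by one with probability \<open>2 ^ - D\<close>, hence \<open>2 ^ D\<close> by one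
  in expectation.  Such a request is paid for by the requested item, which was either not yet
  requested or had overtaken \<open>v\<close>.  In a step at depth \<open>D\<close>, each of the at most \<open>min (2 ^ D) r\<close>
  items of \<open>W\<close> at the same depth as \<open>v\<close> overtakes \<open>v\<close> exactly with the probability with which
  \<open>v\<close> is pushed.  So the overtakings are compensated by
  \<open>S(D) = (\<Sum>d<D. min (2 ^ d) r)\<close>: the sum of \<open>2 ^ D - S(D)\<close> and the number of items of \<open>W\<close>
  that are unrequested or deeper than \<open>v\<close> is a supermartingale starting at \<open>r\<close>.  Since
  \<open>S(D) \<le> 2 ^ D / 2 + 2 * r\<close>, the expectation of \<open>2 ^ D\<close> is at most \<open>6 * r\<close>, and Jensen's
  inequality bounds that of \<open>D\<close> by \<open>log 2 (6 * r) < log 2 r + 3\<close>.\<close>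

section \<open>Expectations over uniformly random paths\<close>

lemma set_random_path: "set_pmf (random_path k) = {p. length p = k}"
  unfolding random_path_def by (auto simp: set_replicate_pmf)

lemma finite_set_random_path [simp]: "finite (set_pmf (random_path k))"
  unfolding set_random_path using finite_lists_length_eq[OF finite, of UNIV k] by simp

lemma expectation_mono_finite_pmf:
  fixes f g :: "'a \<Rightarrow> real"
  assumes "finite (set_pmf p)" "\<And>x. x \<in> set_pmf p \<Longrightarrow> f x \<le> g x"
  shows "measure_pmf.expectation p f \<le> measure_pmf.expectation p g"
  using assms by (intro integral_mono_AE AE_pmfI integrable_measure_pmf_finite)

lemma expectation_bind_finite_pmf:
  fixes h :: "'b \<Rightarrow> real"
  assumes "finite (set_pmf p)" "\<And>x. x \<in> set_pmf p \<Longrightarrow> finite (set_pmf (f x))"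
  shows "measure_pmf.expectation (bind_pmf p f) h =
    measure_pmf.expectation p (\<lambda>x. measure_pmf.expectation (f x) h)"
proof -
  have "measure_pmf.expectation (bind_pmf p f) h =
      (\<Sum>x\<in>set_pmf p. pmf p x *\<^sub>R measure_pmf.expectation (f x) h)"
    using assms by (intro pmf_expectation_bind) auto
  also have "\<dots> = measure_pmf.expectation p (\<lambda>x. measure_pmf.expectation (f x) h)"
    using assms by (intro integral_measure_pmf[symmetric]) auto
  finally show ?thesis .
qed

lemma expectation_random_path_Suc:
  fixes h :: "server \<Rightarrow> real"
  shows "measure_pmf.expectation (random_path (Suc k)) h =
    (measure_pmf.expectation (random_path k) (\<lambda>p. h (False # p)) +
     measure_pmf.expectation (random_path k) (\<lambda>p. h (True # p))) / 2"
proof -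
  have "random_path (Suc k) = pmf_of_set UNIV \<bind> (\<lambda>b. map_pmf ((#) b) (random_path k))"
    unfolding random_path_def by (simp add: map_pmf_def)
  then show ?thesis
    by (simp add: pmf_expectation_bind_pmf_of_set UNIV_bool field_simps)
qed

lemma expectation_prefix_random_path:
  "length q \<le> k \<Longrightarrow>
   measure_pmf.expectation (random_path k) (\<lambda>p. of_bool (prefix q p)) = (1 / 2 ^ length q :: real)"
proof (induction k arbitrary: q)
  case 0
  then show ?case by simp
next
  case (Suc k)
  show ?case
  proof (cases q)
    case Nil
    then show ?thesis by simp
  next
    case (Cons b q')
    with Suc have "measure_pmf.expectation (random_path k) (\<lambda>p. of_bool (prefix q' p))
        = (1 / 2 ^ length q' :: real)"
      by simp
    then show ?thesis
      by (cases b) (simp_all add: Cons expectation_random_path_Suc)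
  qed
qed

section \<open>Injectivity of the placement under a push\<close>

text \<open>The effect of a push along \<open>p\<close> on servers rather than items, where \<open>q\<close> hosts the
  requested item.\<close>

definition shift_down :: "server \<Rightarrow> server \<Rightarrow> server \<Rightarrow> server" where
  "shift_down q p s = (if s = q then [] else if strict_prefix s p then take (Suc (length s)) p
     else if s = p then q else s)"

text \<open>The map rotates the prefixes of \<open>p\<close>, followed by \<open>q\<close> if
  \<open>p\<close> differs from \<open>q\<close>, in a cycle and fixes every other server. Equal
  lengths keep \<open>q\<close> from being a strict prefix of \<open>p\<close>.\<close>

lemma inj_shift_down:
  assumes "length p = length q"
  shows "inj (shift_down q p)"
proof (rule injI)
  fix s s' assume eq: "shift_down q p s = shift_down q p s'"
  have next_not_Nil: "take (Suc (length a)) p \<noteq> []" if "strict_prefix a p" for a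
    using that by (cases p) auto
  have next_prefix: "prefix (take n p) p" for n
    by (rule take_is_prefix)
  have next_inj: "a = b" if "strict_prefix a p" "strict_prefix b p"
    "take (Suc (length a)) p = take (Suc (length b)) p" for a b
  proof -
    have "length a < length p" "length b < length p"
      using that prefix_length_less by blast+
    then have "length a = length b"
      using arg_cong[OF that(3), of length] by simp
    with that show ?thesis
      by (auto simp: strict_prefix_def prefix_def)
  qed
  have q: "q = p" if "prefix q p"
    using that assms by (auto simp: prefix_def)
  have shift_end: "shift_down q p p = q" if "p \<noteq> q"
    using that by (simp add: shift_down_def)
  have shift_q: "shift_down q p q = []"
    by (simp add: shift_down_def)
  have shift_path: "shift_down q p a = take (Suc (length a)) p" if "a \<noteq> q" "strict_prefix a p" for a
    using that by (simp add: shift_down_def)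
  have shift_off: "shift_down q p a = a" if "a \<noteq> q" "\<not> prefix a p" for a
    using that by (auto simp: shift_down_def strict_prefix_def)
  have cases: "a = q \<or> a \<noteq> q \<and> strict_prefix a p \<or> p \<noteq> q \<and> a = p \<or> a \<noteq> q \<and> \<not> prefix a p" for a
    by (auto simp: strict_prefix_def)
  \<comment> \<open>Whether the image lies on the path tells the two kinds of servers apart, so only
    collisions within one kind remain to be excluded.\<close>
  have on_path: "prefix (shift_down q p a) p \<longleftrightarrow> a = q \<or> a \<noteq> q \<and> strict_prefix a p" for a
    using cases[of a]
    by (elim disjE conjE) (use q in \<open>auto simp: shift_q shift_path shift_end shift_off next_prefix\<close>)
  show "s = s'"
    using cases[of s] cases[of s'] eq on_path[of s] on_path[of s']
    by (metis shift_q shift_path shift_end shift_off next_not_Nil next_inj q)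
qed

lemma inj_on_push_down:
  assumes inj: "inj_on host V" and u: "u \<in> V" and p: "length p = depth (host u)"
  shows "inj_on (push_down host u p) V"
proof -
  have "push_down host u p w = shift_down (host u) p (host w)" if "w \<in> V" for w
    using inj_on_eq_iff[OF inj that u] by (simp add: push_down_def shift_down_def)
  moreover have "inj_on (shift_down (host u) p \<circ> host) V"
    by (rule comp_inj_on[OF inj inj_on_subset[OF inj_shift_down[OF p] subset_UNIV]])
  ultimately show ?thesis
    by (simp cong: inj_on_cong)
qed

text \<open>The item at the end of the path moves to the server of \<open>u\<close>, which has the
  same depth, so only items strictly above the end change depth.\<close>

lemma depth_push_down:
  assumes "length p = depth (host u)" "w \<noteq> u"
  shows "depth (push_down host u p w) =
    depth (host w) + of_bool (strict_prefix (host w) p)"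
  using assms by (auto simp: push_down_def dest: prefix_length_less)

lemma strict_prefix_iff_prefix: "length q < length p \<Longrightarrow> strict_prefix q p \<longleftrightarrow> prefix q p"
  by (auto simp: strict_prefix_def)

section \<open>The potential and its change along a fixed path\<close>

definition compensation :: "nat \<Rightarrow> nat \<Rightarrow> real" where
  "compensation r D = (\<Sum>d<D. min (2 ^ d) (real r))"

text \<open>As long as \<open>2 ^ D\<close> is at most \<open>2 * r\<close>, the geometric sum
  suffices; afterwards each new summand is at most \<open>r\<close>, less than the growth
  \<open>2 ^ D / 2\<close> of the right-hand side.\<close>

lemma compensation_le: "compensation r D \<le> 2 ^ D / 2 + 2 * real r"
proof (induction D)
  case 0
  then show ?case by (simp add: compensation_def)
next
  case (Suc D)
  show ?case
  proof (cases "(2::real) ^ D \<le> 2 * real r")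
    case True
    have "compensation r (Suc D) \<le> (\<Sum>d<Suc D. 2 ^ d)"
      unfolding compensation_def by (rule sum_mono) simp
    also have "\<dots> \<le> 2 ^ Suc D"
      using geometric_sum[of "2::real" "Suc D"] by simp
    finally show ?thesis using True by simp
  next
    case False
    have "compensation r (Suc D) \<le> compensation r D + real r"
      by (simp add: compensation_def)
    with Suc False show ?thesis by simp
  qed
qed

text \<open>\<open>Q\<close> stands for the items of \<open>W\<close> that have not been requested since the last
  request of \<open>v\<close>.\<close>

definition creditors :: "'a placement \<Rightarrow> 'a \<Rightarrow> 'a set \<Rightarrow> 'a set \<Rightarrow> 'a set" where
  "creditors host v W Q = {w \<in> W. w \<in> Q \<or> depth (host v) < depth (host w)}"

definition potential :: "'a \<Rightarrow> 'a set \<Rightarrow> 'a set \<Rightarrow> 'a placement \<Rightarrow> real" where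
  "potential v W Q host = 2 ^ depth (host v) + real (card (creditors host v W Q))
     - compensation (Suc (card W)) (depth (host v))"

lemma potential_ge:
  "2 ^ depth (host v) / 2 - 2 * real (Suc (card W)) \<le> potential v W Q host"
  using compensation_le[of "Suc (card W)" "depth (host v)"] by (simp add: potential_def)

text \<open>No pushed item ends deeper than \<open>v\<close>, and \<open>v\<close> keeps its depth,
  so no creditor is gained, whichever path is drawn.\<close>

lemma potential_push_down_shallow:
  assumes p: "length p = depth (host u)" and k: "depth (host u) \<le> depth (host v)"
    and "u \<noteq> v" "finite W"
  shows "potential v W (Q - {u}) (push_down host u p) \<le> potential v W Q host"
proof -
  have v: "depth (push_down host u p v) = depth (host v)"
    using assms by (auto simp: depth_push_down dest: prefix_length_less)
  have "creditors (push_down host u p) v W (Q - {u}) \<subseteq> creditors host v W Q"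
  proof
    fix w assume w: "w \<in> creditors (push_down host u p) v W (Q - {u})"
    show "w \<in> creditors host v W Q"
    proof (cases "w = u")
      case True
      with w show ?thesis by (auto simp: creditors_def push_down_def)
    next
      case False
      with w p k v show ?thesis
        by (auto simp: creditors_def depth_push_down of_bool_def split: if_splits dest: prefix_length_less)
    qed
  qed
  then have "card (creditors (push_down host u p) v W (Q - {u})) \<le> card (creditors host v W Q)"
    using \<open>finite W\<close> by (intro card_mono) (auto simp: creditors_def)
  then show ?thesis by (simp add: potential_def v)
qed

text \<open>The \<open>- 1\<close> is the payment by \<open>u\<close>, a creditor that goes to the
  root. The next term is the growth of \<open>2 ^ D - S(D)\<close> if \<open>v\<close> is pushed;
  the sum covers the items that may overtake \<open>v\<close>, which must start at its
  depth.\<close>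

lemma potential_push_down_deep:
  assumes p: "length p = depth (host u)" and k: "depth (host v) < depth (host u)"
    and "u \<in> W" "v \<notin> W" "finite W"
  shows "potential v W (Q - {u}) (push_down host u p) \<le> potential v W Q host - 1
    + of_bool (prefix (host v) p) * (2 ^ depth (host v) - min (2 ^ depth (host v)) (real (Suc (card W))))
    + (\<Sum>w\<in>{w\<in>W. depth (host w) = depth (host v)}. of_bool (prefix (host w) p))"
proof -
  let ?D = "depth (host v)" and ?host' = "push_down host u p"
  let ?M = "{w\<in>W. depth (host w) = ?D}"
  let ?M' = "{w\<in>?M. prefix (host w) p}"
  have uv: "u \<noteq> v" using assms by auto
  have v: "depth (?host' v) = ?D + of_bool (prefix (host v) p)"
    using assms uv by (simp add: depth_push_down strict_prefix_iff_prefix)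
  have "creditors ?host' v W (Q - {u}) \<subseteq> (creditors host v W Q - {u}) \<union> ?M'"
  proof
    fix w assume w: "w \<in> creditors ?host' v W (Q - {u})"
    show "w \<in> (creditors host v W Q - {u}) \<union> ?M'"
    proof (cases "w = u")
      case True
      with w show ?thesis by (auto simp: creditors_def push_down_def)
    next
      case False
      with w p v show ?thesis
        by (auto simp: creditors_def depth_push_down strict_prefix_def of_bool_def split: if_splits)
    qed
  qed
  then have "card (creditors ?host' v W (Q - {u})) \<le> card ((creditors host v W Q - {u}) \<union> ?M')"
    using \<open>finite W\<close> by (intro card_mono) (auto simp: creditors_def)
  also have "\<dots> \<le> card (creditors host v W Q - {u}) + card ?M'"
    by (rule card_Un_le)
  finally have "card (creditors ?host' v W (Q - {u})) \<le> card (creditors host v W Q - {u}) + card ?M'" .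
  moreover have "Suc (card (creditors host v W Q - {u})) = card (creditors host v W Q)"
    using assms by (intro card.remove[symmetric]) (auto simp: creditors_def)
  moreover have "real (card ?M') = (\<Sum>w\<in>?M. of_bool (prefix (host w) p))"
    using \<open>finite W\<close> by (simp add: Int_def)
  ultimately have "real (card (creditors ?host' v W (Q - {u}))) \<le>
      real (card (creditors host v W Q)) - 1 + (\<Sum>w\<in>?M. of_bool (prefix (host w) p))"
    by linarith
  then show ?thesis
    by (auto simp: potential_def v compensation_def)
qed

text \<open>In the deep case the expected change is at most
  \<open>- 1 + (1 - ?m / 2 ^ ?D) + card ?M / 2 ^ ?D\<close>, which is nonpositive because
  \<open>card ?M\<close> is at most \<open>?m\<close>.\<close>

lemma expectation_potential_serve:
  assumes inj: "inj_on host V" and "W \<subseteq> V" and "u \<in> W" "v \<notin> W" "finite W"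
  shows "measure_pmf.expectation (random_push_serve host u) (potential v W (Q - {u}))
    \<le> potential v W Q host"
proof -
  let ?D = "depth (host v)" and ?k = "depth (host u)" and ?R = "random_path (depth (host u))"
  have uv: "u \<noteq> v" using assms by auto
  note [simp] = integrable_measure_pmf_finite[OF finite_set_random_path]
  show ?thesis
  proof (cases "?k \<le> ?D")
    case True
    have "measure_pmf.expectation ?R (\<lambda>p. potential v W (Q - {u}) (push_down host u p))
        \<le> measure_pmf.expectation ?R (\<lambda>p. potential v W Q host)"
      using True uv \<open>finite W\<close>
      by (intro expectation_mono_finite_pmf finite_set_random_path potential_push_down_shallow)
         (auto simp: set_random_path)
    then show ?thesis by (simp add: random_push_serve_def)
  next
    case False
    let ?M = "{w\<in>W. depth (host w) = ?D}"
    let ?m = "min (2 ^ ?D) (real (Suc (card W)))"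
    have le_W: "card ?M \<le> card W"
      using \<open>finite W\<close> by (intro card_mono) auto
    \<comment> \<open>Distinct items occupy distinct servers, and level \<open>?D\<close> has
      \<open>2 ^ ?D\<close> of them.\<close>
    have "card ?M \<le> card {s :: server. length s = ?D}"
    proof (rule card_inj_on_le)
      show "inj_on host ?M"
        using inj \<open>W \<subseteq> V\<close> by (auto intro: inj_on_subset)
      show "finite {s :: server. length s = ?D}"
        using finite_lists_length_eq[OF finite, of UNIV ?D] by simp
    qed auto
    also have "\<dots> = 2 ^ ?D"
      using card_lists_length_eq[OF finite, of "UNIV :: bool set" ?D] by simp
    finally have "real (card ?M) \<le> real (2 ^ ?D)"
      by (rule of_nat_mono)
    with le_W have "real (card ?M) \<le> ?m"
      by simp
    then have M: "real (card ?M) / 2 ^ ?D \<le> ?m / 2 ^ ?D"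
      by (intro divide_right_mono) auto
    have "measure_pmf.expectation ?R (\<lambda>p. potential v W (Q - {u}) (push_down host u p))
        \<le> measure_pmf.expectation ?R (\<lambda>p. potential v W Q host - 1
            + of_bool (prefix (host v) p) * (2 ^ ?D - ?m)
            + (\<Sum>w\<in>?M. of_bool (prefix (host w) p)))"
      using False assms
      by (intro expectation_mono_finite_pmf finite_set_random_path potential_push_down_deep)
         (auto simp: set_random_path)
    \<comment> \<open>The path is longer than \<open>?D\<close>, so it visits each server of that
      level with probability \<open>1 / 2 ^ ?D\<close>.\<close>
    also have "\<dots> = potential v W Q host - 1 + (2 ^ ?D - ?m) / 2 ^ ?D + real (card ?M) / 2 ^ ?D"
      using False by (simp add: expectation_prefix_random_path)
    also have "\<dots> \<le> potential v W Q host"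
      using M by (simp add: diff_divide_distrib)
    finally show ?thesis by (simp add: random_push_serve_def)
  qed
qed

section \<open>Iteration over the request sequence\<close>

lemma finite_set_random_push_after: "finite (set_pmf (random_push_after init \<sigma> n))"
  by (induction n) (auto simp: random_push_serve_def)

lemma inj_on_random_push_after:
  assumes "inj_on init V" "\<And>i. i \<ge> 1 \<Longrightarrow> \<sigma> i \<in> V"
  shows "host \<in> set_pmf (random_push_after init \<sigma> n) \<Longrightarrow> inj_on host V"
proof (induction n arbitrary: host)
  case 0
  then show ?case using assms by simp
next
  case (Suc n)
  then show ?case
    using assms(2) by (auto simp: random_push_serve_def set_random_path intro!: inj_on_push_down)
qed

lemma expectation_random_push_after_Suc:
  fixes h :: "'a placement \<Rightarrow> real"
  shows "measure_pmf.expectation (random_push_after init \<sigma> (Suc n)) h =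
    measure_pmf.expectation (random_push_after init \<sigma> n)
      (\<lambda>host. measure_pmf.expectation (random_push_serve host (\<sigma> (Suc n))) h)"
  unfolding random_push_after.simps
  by (rule expectation_bind_finite_pmf[OF finite_set_random_push_after])
     (simp add: random_push_serve_def)

lemma random_push_after_request:
  assumes "host \<in> set_pmf (random_push_after init \<sigma> m)" "m \<ge> 1"
  shows "host (\<sigma> m) = []"
  using assms by (cases m) (auto simp: random_push_serve_def push_down_def)

lemma expectation_potential_after:
  assumes inj: "inj_on init V" and req: "\<And>i. i \<ge> 1 \<Longrightarrow> \<sigma> i \<in> V"
    and "s \<ge> 1" "\<sigma> s = v" and W: "W = \<sigma> ` {s<..<t}" "v \<notin> W"
    and "s \<le> n" "n < t"
  shows "measure_pmf.expectation (random_push_after init \<sigma> n)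
    (potential v W (W - \<sigma> ` {s<..n})) \<le> Suc (card W)"
  using \<open>s \<le> n\<close> \<open>n < t\<close>
proof (induction n rule: dec_induct)
  case base
  \<comment> \<open>Right after its request \<open>v\<close> is at the root and all of
    \<open>W\<close> is still unrequested, so the potential is
    \<open>2 ^ 0 + card W - 0\<close>.\<close>
  have "potential v W W host = real (Suc (card W))"
    if "host \<in> set_pmf (random_push_after init \<sigma> s)" for host
  proof -
    have "host v = []"
      using random_push_after_request[OF that] \<open>s \<ge> 1\<close> \<open>\<sigma> s = v\<close> by simp
    moreover have "creditors host v W W = W"
      by (auto simp: creditors_def)
    ultimately show ?thesis
      by (simp add: potential_def compensation_def)
  qed
  then have "measure_pmf.expectation (random_push_after init \<sigma> s) (potential v W W)
      = measure_pmf.expectation (random_push_after init \<sigma> s) (\<lambda>_. real (Suc (card W)))"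
    by (intro integral_cong_AE AE_pmfI) simp_all
  then show ?case by simp
next
  case (step n)
  let ?P = "random_push_after init \<sigma> n" and ?u = "\<sigma> (Suc n)" and ?Q = "W - \<sigma> ` {s<..n}"
  have Q: "W - \<sigma> ` {s<..Suc n} = ?Q - {?u}"
    using \<open>s \<le> n\<close> by (auto simp: le_Suc_eq)
  have u: "?u \<in> W" "W \<subseteq> V" "finite W"
    using step W \<open>s \<ge> 1\<close> req by auto
  have "measure_pmf.expectation (random_push_after init \<sigma> (Suc n))
        (potential v W (W - \<sigma> ` {s<..Suc n}))
      = measure_pmf.expectation ?P
        (\<lambda>host. measure_pmf.expectation (random_push_serve host ?u) (potential v W (?Q - {?u})))"
    by (simp only: expectation_random_push_after_Suc Q)
  also have "\<dots> \<le> measure_pmf.expectation ?P (potential v W ?Q)"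
    using u \<open>v \<notin> W\<close> inj_on_random_push_after[of init V \<sigma>, OF inj req]
    by (intro expectation_mono_finite_pmf finite_set_random_push_after
        expectation_potential_serve[where V = V])
  also have "\<dots> \<le> Suc (card W)"
    using step by simp
  finally show ?case .
qed

section \<open>From the potential to the expected depth\<close>

lemma depth_le_exp_tangent:
  assumes "c > 0"
  shows "real D * ln 2 \<le> 2 ^ D / c - 1 + ln c"
proof -
  \<comment> \<open>This is the tangent of \<open>ln\<close> at \<open>c\<close>; averaging it
    replaces Jensen's inequality.\<close>
  have "ln (2 ^ D / c) \<le> 2 ^ D / c - 1"
    using assms by (intro ln_le_minus_one) simp
  then show ?thesis
    using assms by (simp add: ln_div ln_realpow)
qed

lemma last_request:
  assumes "\<exists>i\<in>{1..<t}. \<sigma> i = v"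
  shows "1 \<le> last_request \<sigma> t v" "last_request \<sigma> t v < t" "\<sigma> (last_request \<sigma> t v) = v"
    "v \<notin> \<sigma> ` {last_request \<sigma> t v<..<t}"
proof -
  let ?A = "{i \<in> {1..<t}. \<sigma> i = v}"
  have "Max ?A \<in> ?A"
    using assms by (intro Max_in) auto
  then show *: "1 \<le> last_request \<sigma> t v" "last_request \<sigma> t v < t" "\<sigma> (last_request \<sigma> t v) = v"
    by (auto simp: last_request_def)
  show "v \<notin> \<sigma> ` {last_request \<sigma> t v<..<t}"
  proof
    assume "v \<in> \<sigma> ` {last_request \<sigma> t v<..<t}"
    then obtain i where i: "last_request \<sigma> t v < i" "i < t" "\<sigma> i = v"
      by auto
    then have "i \<le> last_request \<sigma> t v"
      unfolding last_request_def by (intro Max_ge) auto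
    with i show False
      by simp
  qed
qed

lemma expected_exp_depth_le:
  assumes inj: "inj_on init V" and req: "\<And>i. i \<ge> 1 \<Longrightarrow> \<sigma> i \<in> V" and rank: "has_rank \<sigma> t v r"
  shows "measure_pmf.expectation (random_push_at init \<sigma> t) (\<lambda>host. 2 ^ depth (host v)) \<le> 6 * real r"
proof -
  define s where "s = last_request \<sigma> t v"
  define W where "W = \<sigma> ` {s<..<t}"
  let ?P = "random_push_after init \<sigma> (t - 1)"
  note [simp] = integrable_measure_pmf_finite[OF finite_set_random_push_after]
  have s: "1 \<le> s" "s < t" "\<sigma> s = v" "v \<notin> W"
    using last_request[of t \<sigma> v] rank by (auto simp: s_def W_def has_rank_def)
  have "{s..<t} = insert s {s<..<t}"
    using s by auto
  then have "r = Suc (card W)"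
    using rank s by (auto simp: has_rank_def W_def s_def[symmetric])
  \<comment> \<open>Half of the expectation of \<open>2 ^ D\<close>, less \<open>2 * r\<close>, is
    at most \<open>r\<close>; this gives the factor 6.\<close>
  have "measure_pmf.expectation ?P (\<lambda>host. 2 ^ depth (host v) / 2 - 2 * real r)
      \<le> measure_pmf.expectation ?P (potential v W (W - \<sigma> ` {s<..t - 1}))"
    unfolding \<open>r = Suc (card W)\<close> by (intro integral_mono potential_ge) auto
  also have "\<dots> \<le> real r"
    using expectation_potential_after[OF inj req s(1) s(3) W_def s(4), of "t - 1"] s
    by (simp add: \<open>r = Suc (card W)\<close>)
  finally show ?thesis
    by (simp add: random_push_at_def)
qed

theorem theorem7:
  fixes V :: "'a set" and L :: nat and init :: "'a placement"
    and \<sigma> :: "nat \<Rightarrow> 'a" and t r :: nat and v :: 'a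
  assumes init: "bij_betw init V (servers L)"
    and requests: "\<And>i. i \<ge> 1 \<Longrightarrow> \<sigma> i \<in> V"
    and "t \<ge> 1" and "r \<ge> 1"
    and item: "v \<in> V" "has_rank \<sigma> t v r"
  shows "expected_depth init \<sigma> t v < log 2 (real r) + 3 \<and>
         expected_depth init \<sigma> t v < real_of_int \<lfloor>log 2 (real r)\<rfloor> + 4"
proof -
  let ?P = "random_push_at init \<sigma> t"
  \<comment> \<open>With \<open>c\<close> bounding the expectation of \<open>2 ^ D\<close>, the
    tangent's linear part is nonpositive on average.\<close>
  define c where "c = 6 * real r"
  have c: "c > 0" using \<open>r \<ge> 1\<close> by (simp add: c_def)
  have [simp]: "integrable ?P f" for f :: "'a placement \<Rightarrow> real"
    unfolding random_push_at_def by (rule integrable_measure_pmf_finite[OF finite_set_random_push_after])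
  have "expected_depth init \<sigma> t v * ln 2
      = measure_pmf.expectation ?P (\<lambda>host. real (depth (host v)) * ln 2)"
    by (simp add: expected_depth_def)
  also have "\<dots> \<le> measure_pmf.expectation ?P (\<lambda>host. 2 ^ depth (host v) / c - 1 + ln c)"
    using c by (intro integral_mono depth_le_exp_tangent) auto
  also have "\<dots> = measure_pmf.expectation ?P (\<lambda>host. 2 ^ depth (host v)) / c - 1 + ln c"
    by simp
  also have "\<dots> \<le> ln c"
    using expected_exp_depth_le[OF bij_betw_imp_inj_on[OF init] requests item(2)] c
    by (simp add: c_def)
  finally have "expected_depth init \<sigma> t v \<le> log 2 c"
    by (simp add: log_def field_simps)
  \<comment> \<open>Passing from 6 to 8 makes the bound strict and yields the summand 3.\<close>
  also have "log 2 c < log 2 (8 * real r)"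
    using \<open>r \<ge> 1\<close> by (simp add: c_def)
  also have "\<dots> = log 2 (real r) + 3"
    using \<open>r \<ge> 1\<close> log_pow_cancel[of "2::real" 3] by (simp add: log_mult)
  finally have "expected_depth init \<sigma> t v < log 2 (real r) + 3" .
  then show ?thesis by linarith
qed

end
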